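(* Let $q$ be a prime power and let $\mathbb{F}_q[[t]]$ be the ring of formal power series over the finite field $\mathbb{F}_q$. For every integer $n>1$ there exists a subset $E\subset \mathbb{F}_q[[t]]^n$ of Haar measure $0$ which contains a line in every direction; that is, for every $v\in \mathbb{F}_q[[t]]^n$ there is $x\in\mathbb{F}_q[[t]]^n$ such that $x+sv\in E$ for all $s\in\mathbb{F}_q[[t]]$.
   Context: For a ring $R$, the line with direction vector $v\in R^n$ through the point $x\in R^n$ is the set $\{x+sv : s\in R\}$. The measure on $\mathbb{F}_q[[t]]^n$ is the (finite) Haar measure of the compact additive group $\mathbb{F}_q[[t]]^n$ with its $t$-adic (product) topology. *)

theory Defs
  imports
    "HOL-Analysis.Analysis"
    "HOL-Computational_Algebra.Formal_Power_Series"
    "HOL-Probability.Infinite_Product_Measure"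
begin

text \<open>
  Haar measures of a compact abelian group, normalised only up to a positive scalar. Regularity is
  not required: on a compact metrizable group such as the additive group of
  \<^typ>\<open>'a::{field,finite} fps ^ 'n\<close> every finite Borel measure is regular. The topology on
  \<^typ>\<open>'a fps\<close> is the library's \<open>t\<close>-adic one, given by the metric
  \<open>2 ^ (- subdegree (f - g))\<close>, and that on vectors is the product topology.
\<close>

definition haar_measure :: "'g::{topological_space, ab_group_add} measure \<Rightarrow> bool" where
  "haar_measure M \<longleftrightarrow>
     sets M = sets borel \<and>
     finite_measure M \<and>
     emeasure M (space M) \<noteq> 0 \<and>
     (\<forall>g. \<forall>A \<in> sets M. emeasure M ((\<lambda>x. g + x) ` A) = emeasure M A)"

text \<open>
  The hypothesis \<^const>\<open>haar_measure\<close> is satisfiable on the groups of interest: the image of the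
  product of the uniform measures on the coefficients is a Haar measure.
\<close>

definition coeff_measure :: "('n \<times> nat \<Rightarrow> 'a::finite) measure" where
  "coeff_measure = PiM UNIV (\<lambda>_. uniform_count_measure UNIV)"

definition vec_of_coeffs :: "('n::finite \<times> nat \<Rightarrow> 'a) \<Rightarrow> 'a fps ^ 'n" where
  "vec_of_coeffs w = (\<chi> i. Abs_fps (\<lambda>k. w (i, k)))"

lemma vec_of_coeffs_nth [simp]: "fps_nth (vec_of_coeffs w $ i) k = w (i, k)"
  by (simp add: vec_of_coeffs_def)

lemma prob_space_uniform_count_UNIV:
  "prob_space (uniform_count_measure (UNIV :: 'a::finite set))"
  by (rule prob_space_uniform_count_measure) auto

lemma space_coeff_measure [simp]: "space coeff_measure = UNIV"
  by (simp add: coeff_measure_def space_PiM space_uniform_count_measure)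

lemma prob_space_coeff_measure: "prob_space coeff_measure"
  unfolding coeff_measure_def by (intro prob_space_PiM prob_space_uniform_count_UNIV)

lemma coeff_measurable: "(\<lambda>w. w p) \<in> coeff_measure \<rightarrow>\<^sub>M count_space UNIV"
proof -
  have "(\<lambda>w. w p) \<in> coeff_measure \<rightarrow>\<^sub>M uniform_count_measure UNIV"
    unfolding coeff_measure_def by (rule measurable_component_singleton) simp
  then show ?thesis
    by (subst (asm) measurable_cong_sets[OF refl sets_uniform_count_measure_count_space])
qed

lemma cylinder_in_coeff_measure:
  assumes "finite J"
  shows "{w. \<forall>p\<in>J. w p = \<eta> p} \<in> sets coeff_measure"
proof -
  have "{w \<in> space coeff_measure. w p = \<eta> p} \<in> sets coeff_measure" for p
    using measurable_sets[OF coeff_measurable, of "{\<eta> p}" p] by (simp add: vimage_def)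
  then have "{w \<in> space coeff_measure. \<forall>p\<in>J. w p = \<eta> p} \<in> sets coeff_measure"
    using assms by (intro sets.sets_Collect_finite_All) auto
  then show ?thesis by simp
qed

lemma finite_dependence_in_coeff_measure:
  fixes P :: "('n \<times> nat \<Rightarrow> 'a::finite) \<Rightarrow> bool"
  assumes "finite J" and dep: "\<And>w w'. (\<forall>p\<in>J. w p = w' p) \<Longrightarrow> P w \<Longrightarrow> P w'"
  shows "{w. P w} \<in> sets coeff_measure"
proof -
  let ?S = "(\<lambda>w. restrict w J) ` {w. P w}"
  have sub: "?S \<subseteq> PiE J (\<lambda>_. UNIV)" by auto
  have "finite (PiE J (\<lambda>_. UNIV :: 'a set))" by (rule finite_PiE[OF assms(1)]) simp
  then have fin: "finite ?S" by (rule finite_subset[OF sub])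
  have "{w. P w} = (\<Union>\<eta>\<in>?S. {w. \<forall>p\<in>J. w p = \<eta> p})"
  proof (intro set_eqI iffI)
    fix w assume "w \<in> (\<Union>\<eta>\<in>?S. {w. \<forall>p\<in>J. w p = \<eta> p})"
    then obtain w' where "P w'" "\<forall>p\<in>J. w p = restrict w' J p" by auto
    then show "w \<in> {w. P w}" using dep[of w' w] by auto
  qed auto
  also have "\<dots> \<in> sets coeff_measure"
    by (intro sets.finite_UN fin cylinder_in_coeff_measure assms(1))
  finally show ?thesis .
qed

lemma open_fps_vec_imp_cylinder:
  fixes U :: "('a::group_add fps ^ 'n) set"
  assumes "open U" and "x \<in> U"
  shows "\<exists>k. \<forall>y. (\<forall>i. \<forall>j<k. fps_nth (y $ i) j = fps_nth (x $ i) j) \<longrightarrow> y \<in> U"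
proof -
  obtain A where A: "\<And>i. open (A i)" "\<And>i. x $ i \<in> A i" "\<And>y. (\<forall>i. y $ i \<in> A i) \<Longrightarrow> y \<in> U"
    using assms unfolding open_vec_def by metis
  have "\<exists>k. \<forall>f. fps_cutoff k f = fps_cutoff k (x $ i) \<longrightarrow> f \<in> A i" for i
    using A(1,2)[of i] unfolding open_fps_iff by blast
  then obtain k where k: "\<And>i f. fps_cutoff (k i) f = fps_cutoff (k i) (x $ i) \<Longrightarrow> f \<in> A i"
    by metis
  have le: "k i \<le> Max (range k)" for i by simp
  have "y \<in> U" if y: "\<forall>i. \<forall>j<Max (range k). fps_nth (y $ i) j = fps_nth (x $ i) j" for y
  proof (rule A(3), intro allI k)
    fix i show "fps_cutoff (k i) (y $ i) = fps_cutoff (k i) (x $ i)"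
      using y less_le_trans[OF _ le[of i]] by (simp add: fps_cutoff_eq_fps_cutoff_iff)
  qed
  then show ?thesis by blast
qed

lemma vec_of_coeffs_measurable:
  "(vec_of_coeffs :: ('n::finite \<times> nat \<Rightarrow> 'a::{finite, group_add}) \<Rightarrow> _)
     \<in> coeff_measure \<rightarrow>\<^sub>M borel"
proof (rule borel_measurableI)
  fix U :: "('a fps ^ 'n) set" assume U: "open U"
  define Q where "Q k w \<longleftrightarrow>
      (\<forall>y::'a fps ^ 'n. (\<forall>i. \<forall>j<k. fps_nth (y $ i) j = w (i, j)) \<longrightarrow> y \<in> U)" for k w
  have Q: "{w. Q k w} \<in> sets coeff_measure" for k
    by (rule finite_dependence_in_coeff_measure[of "UNIV \<times> {..<k}"]) (auto simp: Q_def)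
  have "vec_of_coeffs w \<in> U \<longleftrightarrow> (\<exists>k. Q k w)" for w
    using open_fps_vec_imp_cylinder[OF U, of "vec_of_coeffs w"] by (auto simp: Q_def)
  then have "vec_of_coeffs -` U \<inter> space coeff_measure = (\<Union>k. {w. Q k w})" by auto
  then show "vec_of_coeffs -` U \<inter> space coeff_measure \<in> sets coeff_measure" using Q by auto
qed

lemma coeff_translation_measurable:
  fixes \<eta> :: "'n \<times> nat \<Rightarrow> 'a::{finite, group_add}"
  shows "(\<lambda>w p. \<eta> p + w p) \<in> coeff_measure \<rightarrow>\<^sub>M coeff_measure"
proof -
  have "(\<lambda>w. \<eta> p + w p) \<in> coeff_measure \<rightarrow>\<^sub>M uniform_count_measure UNIV" for p
    unfolding measurable_cong_sets[OF refl sets_uniform_count_measure_count_space]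
    by (rule measurable_compose[OF coeff_measurable]) simp
  then have "(\<lambda>w. \<lambda>p\<in>UNIV. \<eta> p + w p)
      \<in> coeff_measure \<rightarrow>\<^sub>M PiM UNIV (\<lambda>_. uniform_count_measure (UNIV :: 'a set))"
    by (intro measurable_restrict)
  then show ?thesis by (simp add: coeff_measure_def restrict_def)
qed

lemma coeff_measure_translation:
  fixes \<eta> :: "'n \<times> nat \<Rightarrow> 'a::{finite, group_add}"
  shows "distr coeff_measure coeff_measure (\<lambda>w p. \<eta> p + w p) = coeff_measure"
proof -
  let ?M = "\<lambda>_ :: 'n \<times> nat. uniform_count_measure (UNIV :: 'a set)"
  interpret product_prob_space ?M UNIV
    by (intro product_prob_spaceI prob_space_uniform_count_UNIV)
  have "distr coeff_measure coeff_measure (\<lambda>w p. \<eta> p + w p) = PiM UNIV ?M"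
  proof (rule PiM_eq)
    fix J :: "('n \<times> nat) set" and F :: "'n \<times> nat \<Rightarrow> 'a set"
    assume J: "finite J"
    have emb: "prod_emb UNIV ?M J (PiE J G) = {w. \<forall>p\<in>J. w p \<in> G p}" for G :: "'n \<times> nat \<Rightarrow> 'a set"
      by (auto simp: prod_emb_def space_uniform_count_measure PiE_iff)
    have meas: "prod_emb UNIV ?M J (PiE J G) \<in> sets coeff_measure" for G :: "'n \<times> nat \<Rightarrow> 'a set"
      unfolding coeff_measure_def
      by (intro sets_PiM_I) (use J in \<open>auto simp: sets_uniform_count_measure\<close>)
    have em: "emeasure coeff_measure {w. \<forall>p\<in>J. w p \<in> G p}
        = (\<Prod>p\<in>J. emeasure (uniform_count_measure UNIV) (G p))" for G :: "'n \<times> nat \<Rightarrow> 'a set"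
      using emeasure_PiM_emb[of J G] J
      by (simp add: emb coeff_measure_def sets_uniform_count_measure)
    let ?G = "\<lambda>p. (\<lambda>a. - \<eta> p + a) ` F p"
    have "{w. \<forall>p\<in>J. \<eta> p + w p \<in> F p} = {w. \<forall>p\<in>J. w p \<in> ?G p}"
      by (force simp: image_iff add.assoc[symmetric])
    then have "emeasure (distr coeff_measure coeff_measure (\<lambda>w p. \<eta> p + w p))
          (prod_emb UNIV ?M J (PiE J F)) = emeasure coeff_measure {w. \<forall>p\<in>J. w p \<in> ?G p}"
      using meas[of F] by (simp add: emeasure_distr[OF coeff_translation_measurable] emb vimage_def)
    also have "\<dots> = (\<Prod>p\<in>J. emeasure (uniform_count_measure UNIV) (F p))"
      unfolding em by (intro prod.cong refl) (simp add: emeasure_uniform_count_measure card_image)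
    finally show "emeasure (distr coeff_measure coeff_measure (\<lambda>w p. \<eta> p + w p))
          (prod_emb UNIV ?M J (PiE J F)) = (\<Prod>p\<in>J. emeasure (uniform_count_measure UNIV) (F p))" .
  qed (simp add: coeff_measure_def)
  then show ?thesis by (simp add: coeff_measure_def)
qed

lemma haar_measure_exists:
  "\<exists>M :: ('a::{field, finite} fps ^ 'n) measure. haar_measure M"
proof -
  let ?f = "vec_of_coeffs :: ('n \<times> nat \<Rightarrow> 'a) \<Rightarrow> 'a fps ^ 'n"
  let ?M = "distr coeff_measure borel ?f"
  have f: "?f \<in> coeff_measure \<rightarrow>\<^sub>M borel" by (rule vec_of_coeffs_measurable)
  interpret prob_space ?M by (rule prob_space.prob_space_distr[OF prob_space_coeff_measure f])
  have inv: "emeasure ?M ((\<lambda>x. g + x) ` A) = emeasure ?M A" if A: "A \<in> sets borel" for g A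
  proof -
    define \<eta> where "\<eta> p = - fps_nth (g $ fst p) (snd p)" for p
    have [simp]: "?f (\<lambda>p. \<eta> p + w p) = ?f w - g" for w
      by (simp add: vec_eq_iff fps_eq_iff \<eta>_def)
    have T: "(\<lambda>w p. \<eta> p + w p) \<in> coeff_measure \<rightarrow>\<^sub>M coeff_measure"
      by (rule coeff_translation_measurable)
    have "y \<in> (\<lambda>x. g + x) ` A \<longleftrightarrow> y - g \<in> A" for y
      by (auto simp: image_iff algebra_simps intro!: bexI[of _ "y - g"])
    then have pre: "?f -` ((\<lambda>x. g + x) ` A) = (\<lambda>w p. \<eta> p + w p) -` (?f -` A)" by auto
    have m1: "?f -` A \<in> sets coeff_measure" using measurable_sets[OF f A] by simp
    then have m2: "?f -` ((\<lambda>x. g + x) ` A) \<in> sets coeff_measure"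
      using measurable_sets[OF T] pre by simp
    have gA: "(\<lambda>x. g + x) ` A \<in> sets borel"
    proof -
      have c: "continuous_on UNIV (\<lambda>y :: 'a fps ^ 'n. y - g)"
      proof -
        have "dist (a - g) (b - g) = dist a b" for a b :: "'a fps ^ 'n"
          by (simp add: dist_vec_def dist_fps_def cong: if_cong)
        then show ?thesis unfolding continuous_on_iff by auto
      qed
      have "(\<lambda>x. g + x) ` A = (\<lambda>y. y - g) -` A"
        using \<open>\<And>y. y \<in> (\<lambda>x. g + x) ` A \<longleftrightarrow> y - g \<in> A\<close> by auto
      then show ?thesis
        using measurable_sets[OF borel_measurable_continuous_onI[OF c] A] by simp
    qed
    have "emeasure ?M ((\<lambda>x. g + x) ` A)
        = emeasure (distr coeff_measure coeff_measure (\<lambda>w p. \<eta> p + w p)) (?f -` A)"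
      using gA m1 by (simp add: emeasure_distr[OF f] emeasure_distr[OF T] pre)
    also have "\<dots> = emeasure ?M A"
      using A by (simp add: coeff_measure_translation emeasure_distr[OF f])
    finally show ?thesis .
  qed
  have "haar_measure ?M"
    unfolding haar_measure_def
  proof (intro conjI allI ballI)
    show "finite_measure ?M" by (rule finite_measure_axioms)
    show "emeasure ?M (space ?M) \<noteq> 0" by (simp only: emeasure_space_1) simp
  qed (use inv in auto)
  then show ?thesis by blast
qed

end

theory Submission
  imports Defs "HOL-Library.Discrete_Functions"
begin

text \<open>
  Up to exchanging two coordinates \<open>i \<noteq> j\<close>, every direction satisfies \<open>v\<^sub>j = a v\<^sub>i\<close> for some power
  series \<open>a = \<Sum> a\<^sub>k t\<^sup>k\<close>. Take the line through \<open>x\<close> with \<open>x\<^sub>i = 0\<close> and \<open>x\<^sub>j = - \<Sum> a\<^sub>k c\<^sub>k t\<^sup>k\<close>, where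
  the sequence \<open>c\<close> of power series has, for every \<open>p\<close> and every \<open>m\<close>, a block
  \<open>c\<^sub>N \<equiv> \<dots> \<equiv> c\<^bsub>N+m-1\<^esub> \<equiv> p (mod t\<^sup>m)\<close>. Its points \<open>y\<close> satisfy \<open>y\<^sub>j = \<Sum> a\<^sub>k t\<^sup>k (y\<^sub>i - c\<^sub>k)\<close>. If
  \<open>y\<^sub>i \<equiv> p (mod t\<^sup>m)\<close>, then modulo \<open>t\<^bsup>N+m\<^esup>\<close> the terms with \<open>k \<ge> N\<close> vanish, so that, \<open>y\<^sub>i\<close> being given,
  \<open>y\<^sub>j\<close> takes at most \<open>q\<^sup>N\<close> of the \<open>q\<^bsup>N+m\<^esup>\<close> residues. Hence the union of these lines has outer
  measure at most \<open>q\<^bsup>-m\<^esup>\<close> times the total mass, for every \<open>m\<close>.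
\<close>

definition cylinder :: "('n \<times> nat) set \<Rightarrow> ('n \<times> nat \<Rightarrow> 'a) \<Rightarrow> ('a::zero fps ^ 'n) set" where
  "cylinder J \<eta> = {x. \<forall>p\<in>J. fps_nth (x $ fst p) (snd p) = \<eta> p}"

lemma open_fps_nth_eq: "open {f :: 'a::group_add fps. fps_nth f k = c}"
  unfolding open_fps_iff
proof
  fix f :: "'a fps" assume "f \<in> {f. fps_nth f k = c}"
  then have "{g. fps_cutoff (Suc k) g = fps_cutoff (Suc k) f} \<subseteq> {f. fps_nth f k = c}"
    by (auto simp: fps_cutoff_eq_fps_cutoff_iff)
  then show "\<exists>n. {g. fps_cutoff n g = fps_cutoff n f} \<subseteq> {f. fps_nth f k = c}" ..
qed

lemma open_cylinder:
  fixes \<eta> :: "'n::finite \<times> nat \<Rightarrow> 'a::group_add"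
  assumes "finite J"
  shows "open (cylinder J \<eta>)"
proof -
  have "cylinder J \<eta> = (\<Inter>p\<in>J. (\<lambda>x. x $ fst p) -` {f. fps_nth f (snd p) = \<eta> p})"
    by (auto simp: cylinder_def)
  then show ?thesis
    using assms by (simp only:) (intro open_INT ballI open_vimage_vec_nth open_fps_nth_eq)
qed

lemma translate_cylinder:
  fixes \<eta> :: "'n::finite \<times> nat \<Rightarrow> 'a::ab_group_add"
  shows "(\<lambda>x. vec_of_coeffs \<eta> + x) ` cylinder J (\<lambda>_. 0) = cylinder J \<eta>"
proof (intro equalityI subsetI)
  fix x :: "'a fps ^ 'n"
  assume "x \<in> cylinder J \<eta>"
  then have "x - vec_of_coeffs \<eta> \<in> cylinder J (\<lambda>_. 0)"
    by (auto simp: cylinder_def)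
  then show "x \<in> (\<lambda>x. vec_of_coeffs \<eta> + x) ` cylinder J (\<lambda>_. 0)"
    by (intro image_eqI[of _ _ "x - vec_of_coeffs \<eta>"]) auto
qed (auto simp: cylinder_def)

text \<open>The cylinders over \<open>J\<close> partition the space into q^|J| pieces, where q =
  \<open>CARD('a)\<close>. All are translates of the one with zero coefficients, so they share the
  total mass equally.\<close>

lemma measure_cylinder:
  fixes M :: "('a::{field, finite} fps ^ 'n) measure"
  assumes M: "haar_measure M" and J: "finite J"
  shows "measure M (cylinder J \<eta>) = measure M (space M) / real CARD('a) ^ card J"
proof -
  interpret finite_measure M using M by (simp add: haar_measure_def)
  have sets: "sets M = sets borel" using M by (simp add: haar_measure_def)
  have space: "space M = UNIV" using sets_eq_imp_space_eq[OF sets] by simp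
  have cyl: "cylinder J \<zeta> \<in> sets M" for \<zeta>
    using open_cylinder[OF J, of \<zeta>] by (simp add: sets)
  have "emeasure M ((\<lambda>x. vec_of_coeffs \<zeta> + x) ` cylinder J (\<lambda>_. 0))
      = emeasure M (cylinder J (\<lambda>_. 0))" for \<zeta>
    using M cyl unfolding haar_measure_def by blast
  then have eq: "measure M (cylinder J \<zeta>) = measure M (cylinder J \<eta>)" for \<zeta>
    unfolding translate_cylinder measure_def by metis
  let ?P = "PiE J (\<lambda>_. UNIV :: 'a set)"
  have "UNIV = (\<Union>\<zeta>\<in>?P. cylinder J \<zeta>)"
  proof (intro equalityI subsetI)
    fix x :: "'a fps ^ 'n"
    let ?z = "restrict (\<lambda>p. fps_nth (x $ fst p) (snd p)) J"
    have "?z \<in> ?P" "x \<in> cylinder J ?z" by (auto simp: cylinder_def)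
    then show "x \<in> (\<Union>\<zeta>\<in>?P. cylinder J \<zeta>)" by blast
  qed auto
  then have "measure M (space M) = measure M (\<Union>\<zeta>\<in>?P. cylinder J \<zeta>)"
    by (simp only: space)
  also have "\<dots> = (\<Sum>\<zeta>\<in>?P. measure M (cylinder J \<zeta>))"
  proof (rule finite_measure_finite_Union)
    show "finite ?P" using J by (intro finite_PiE) auto
    show "disjoint_family_on (cylinder J) ?P"
      unfolding disjoint_family_on_def
    proof (intro ballI impI)
      fix \<zeta> \<xi> assume *: "\<zeta> \<in> ?P" "\<xi> \<in> ?P" "\<zeta> \<noteq> \<xi>"
      then obtain p where "p \<in> J" "\<zeta> p \<noteq> \<xi> p" by (metis PiE_ext)
      then show "cylinder J \<zeta> \<inter> cylinder J \<xi> = {}" by (auto simp: cylinder_def)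
    qed
  qed (use cyl in auto)
  also have "\<dots> = (\<Sum>\<zeta>\<in>?P. measure M (cylinder J \<eta>))"
    by (intro sum.cong refl eq)
  also have "\<dots> = real CARD('a) ^ card J * measure M (cylinder J \<eta>)"
    using J by (simp add: card_PiE)
  finally show ?thesis by simp
qed

text \<open>Let \<open>c k\<close> depend on \<open>k\<close> only through
  \<open>floor_log k\<close>, so that it is constant on each dyadic block from 2^p to 2^(p+1) - 1,
  and let p encode the list of coefficients to be shown there. Every finite list then
  occurs.\<close>

lemma block_sequence_exists:
  obtains c :: "nat \<Rightarrow> nat \<Rightarrow> 'a::finite"
  where "\<And>m (f :: nat \<Rightarrow> 'a). \<exists>N. \<forall>j<m. \<forall>l<m. c (N + j) l = f l"
proof
  define c :: "nat \<Rightarrow> nat \<Rightarrow> 'a"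
    where "c k l = (from_nat (fst (prod_decode (floor_log k))) :: 'a list) ! l" for k l
  fix m and f :: "nat \<Rightarrow> 'a"
  \<comment> \<open>Encoding \<open>m\<close> beside the list forces \<open>m\<close> \<le>
    \<open>p\<close> < 2^p, so the dyadic block of \<open>p\<close> has room for \<open>m\<close>
    indices.\<close>
  define p where "p = prod_encode (to_nat (map f [0..<m]), m)"
  have "m \<le> 2 ^ p"
    using le_prod_encode_2[of m] less_exp[of p] unfolding p_def by (meson le_less_trans less_imp_le)
  then have "floor_log (2 ^ p + j) = p" if "j < m" for j
    using that by (intro floor_log_eqI) auto
  then have "\<forall>j<m. \<forall>l<m. c (2 ^ p + j) l = f l"
    by (simp add: c_def p_def)
  then show "\<exists>N. \<forall>j<m. \<forall>l<m. c (N + j) l = f l" by blast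
qed

text \<open>Coefficientwise form of y_j = sum of a_k t^k (y_i - c_k), where \<open>c k\<close> holds
  the coefficients of c_k. The quantifier over \<open>a\<close> takes the union over all slopes; the
  remaining coordinates are free.\<close>

definition line_union :: "(nat \<Rightarrow> nat \<Rightarrow> 'a) \<Rightarrow> 'n \<Rightarrow> 'n \<Rightarrow> ('a::ring_1 fps ^ 'n) set" where
  "line_union c i j =
     {y. \<exists>a. \<forall>n. fps_nth (y $ j) n = (\<Sum>k\<le>n. a k * (fps_nth (y $ i) (n - k) - c k (n - k)))}"

lemma line_in_line_union:
  fixes v :: "'a::field fps ^ 'n"
  assumes "i \<noteq> j" and "v $ i dvd v $ j"
  shows "\<exists>x. \<forall>s. x + s *s v \<in> line_union c i j"
proof -
  obtain a where a: "v $ j = a * v $ i" using assms(2) by (metis dvd_def mult.commute)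
  \<comment> \<open>Since \<open>x $ i\<close> = 0, coordinate \<open>i\<close> of the line is
    \<open>s * v $ i\<close>; coordinate \<open>j\<close> of \<open>x\<close> supplies the shift by
    - sum of a_k c_k t^k.\<close>
  define x :: "'a fps ^ 'n" where
    "x = (\<chi> l. if l = j then Abs_fps (\<lambda>n. - (\<Sum>k\<le>n. fps_nth a k * c k (n - k))) else 0)"
  have "x + s *s v \<in> line_union c i j" for s
    unfolding line_union_def mem_Collect_eq
  proof (intro exI allI)
    fix n
    have sv: "s * v $ j = a * (s * v $ i)" by (simp add: a algebra_simps)
    have "fps_nth ((x + s *s v) $ j) n
        = - (\<Sum>k\<le>n. fps_nth a k * c k (n - k)) + (\<Sum>k\<le>n. fps_nth a k * fps_nth (s * v $ i) (n - k))"
      by (simp add: x_def sv fps_mult_nth[of a] atLeast0AtMost del: mult_cancel_left)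
    then show "fps_nth ((x + s *s v) $ j) n
        = (\<Sum>k\<le>n. fps_nth a k * (fps_nth ((x + s *s v) $ i) (n - k) - c k (n - k)))"
      using assms(1) by (simp add: x_def right_diff_distrib sum_subtractf)
  qed
  then show ?thesis by blast
qed

text \<open>Fix the residue \<open>f\<close> of y_i modulo t^m. At most q^(2 \<open>N f\<close>)
  cylinders, each of relative measure q^(-2 (\<open>N f\<close> + m)), cover the points with this
  residue, so \<open>f\<close> costs q^(-2m). Summing over the q^m residues gives q^(-m).\<close>

lemma line_union_cover:
  fixes M :: "('a::{field, finite} fps ^ 'n) measure"
  assumes M: "haar_measure M" and "i \<noteq> j"
    and c: "\<And>m (f :: nat \<Rightarrow> 'a). \<exists>N. \<forall>j<m. \<forall>l<m. c (N + j) l = f l"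
  shows "\<exists>F. F \<in> sets M \<and> line_union c i j \<subseteq> F
    \<and> measure M F \<le> measure M (space M) / real CARD('a) ^ m"
proof -
  interpret finite_measure M using M by (simp add: haar_measure_def)
  have sets: "sets M = sets borel" using M by (simp add: haar_measure_def)
  let ?q = "real CARD('a)" and ?\<mu> = "measure M (space M)"
  have q: "?q > 0" by simp
  let ?P = "\<lambda>n :: nat. PiE {..<n} (\<lambda>_. UNIV :: 'a set)"
  have fin: "finite (?P n)" for n by (intro finite_PiE) auto
  have card: "card (?P n) = CARD('a) ^ n" for n by (simp add: card_PiE)
  obtain N where N: "\<And>f j l. j < m \<Longrightarrow> l < m \<Longrightarrow> c (N f + j) l = f l"
    using c[of m] by metis
  \<comment> \<open>Coefficients of y_i below \<open>N f + m\<close>: the residue \<open>f\<close>,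
    then \<open>N f\<close> free ones from \<open>\<sigma>\<close>.\<close>
  define s where "s f \<sigma> l = (if l < m then f l else \<sigma> (l - m))" for f \<sigma> :: "nat \<Rightarrow> 'a" and l
  \<comment> \<open>Coefficients of y_j below \<open>N f + m\<close>: only the slope coefficients
    with index below \<open>N f\<close>, recorded in \<open>\<alpha>\<close>, enter.\<close>
  define y where "y f \<sigma> \<alpha> n = (\<Sum>k\<in>{..n} \<inter> {..<N f}. \<alpha> k * (s f \<sigma> (n - k) - c k (n - k)))"
    for f \<sigma> \<alpha> n
  define J where "J f = {i, j} \<times> {..<N f + m}" for f
  define C where "C f = (\<lambda>(\<sigma>, \<alpha>). cylinder (J f)
    (\<lambda>p. if fst p = i then s f \<sigma> (snd p) else y f \<sigma> \<alpha> (snd p)))"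
    for f
  define F where "F f = (\<Union>u\<in>?P (N f) \<times> ?P (N f). C f u)" for f
  have J: "finite (J f)" "card (J f) = 2 * (N f + m)" for f
    using assms(2) by (auto simp: J_def)
  have C: "C f u \<in> sets M" for f u
    unfolding C_def sets by (cases u) (simp add: borel_open open_cylinder[OF J(1)])
  have mC: "measure M (C f u) = ?\<mu> / ?q ^ (2 * (N f + m))" for f u
    by (simp add: C_def measure_cylinder[OF M J(1)] J(2) split: prod.split)
  have F: "F f \<in> sets M" for f
    unfolding F_def using fin C by (intro sets.finite_UN) auto
  have mF: "measure M (F f) \<le> ?\<mu> / ?q ^ (2 * m)" for f
  proof -
    have "measure M (F f) \<le> (\<Sum>u\<in>?P (N f) \<times> ?P (N f). measure M (C f u))"
      unfolding F_def using fin C by (intro measure_UNION_le) auto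
    also have "\<dots> = ?q ^ (2 * N f) * (?\<mu> / ?q ^ (2 * (N f + m)))"
      by (simp add: mC card_cartesian_product card mult_2 power_add)
    also have "\<dots> = ?\<mu> / ?q ^ (2 * m)"
      using q by (simp add: distrib_left power_add)
    finally show ?thesis .
  qed
  have "x \<in> (\<Union>f\<in>?P m. F f)" if x: "x \<in> line_union c i j" for x
  proof -
    obtain a where a: "\<And>n. fps_nth (x $ j) n = (\<Sum>k\<le>n. a k * (fps_nth (x $ i) (n - k) - c k (n - k)))"
      using x by (auto simp: line_union_def)
    define f where "f = restrict (fps_nth (x $ i)) {..<m}"
    define \<sigma> where "\<sigma> = restrict (\<lambda>l. fps_nth (x $ i) (l + m)) {..<N f}"
    define \<alpha> where "\<alpha> = restrict a {..<N f}"
    have s: "fps_nth (x $ i) l = s f \<sigma> l" if "l < N f + m" for l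
      using that by (auto simp: s_def f_def \<sigma>_def)
    have y: "fps_nth (x $ j) n = y f \<sigma> \<alpha> n" if n: "n < N f + m" for n
    proof -
      \<comment> \<open>Here \<open>N f\<close> \<le> \<open>k\<close> \<le> \<open>n\<close> <
        \<open>N f + m\<close>: the index \<open>k\<close> lies in the block of \<open>f\<close> and
        \<open>n - k\<close> < \<open>m\<close>, so both sides equal
        \<open>f (n - k)\<close>.\<close>
      have z: "fps_nth (x $ i) (n - k) = c k (n - k)" if "k \<le> n" "\<not> k < N f" for k
      proof -
        have lt: "k - N f < m" "n - k < m" using that n by auto
        have "c k (n - k) = c (N f + (k - N f)) (n - k)" using that by simp
        also have "\<dots> = f (n - k)" by (rule N[OF lt])
        finally show ?thesis using lt(2) by (simp add: f_def)
      qed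
      have "fps_nth (x $ j) n
          = (\<Sum>k\<in>{..n} \<inter> {..<N f}. a k * (fps_nth (x $ i) (n - k) - c k (n - k)))"
        unfolding a using z by (intro sum.mono_neutral_right) auto
      also have "\<dots> = y f \<sigma> \<alpha> n"
        unfolding y_def using n by (intro sum.cong) (auto simp: \<alpha>_def s)
      finally show ?thesis .
    qed
    have "x \<in> C f (\<sigma>, \<alpha>)"
      using s y assms(2) by (auto simp: C_def cylinder_def J_def)
    moreover have "(\<sigma>, \<alpha>) \<in> ?P (N f) \<times> ?P (N f)" "f \<in> ?P m"
      by (auto simp: \<sigma>_def \<alpha>_def f_def)
    ultimately show ?thesis unfolding F_def by blast
  qed
  moreover have "measure M (\<Union>f\<in>?P m. F f) \<le> ?\<mu> / ?q ^ m"
  proof -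
    have "measure M (\<Union>f\<in>?P m. F f) \<le> (\<Sum>f\<in>?P m. measure M (F f))"
      using fin F by (intro measure_UNION_le) auto
    also have "\<dots> \<le> (\<Sum>f\<in>?P m. ?\<mu> / ?q ^ (2 * m))"
      by (intro sum_mono mF)
    also have "\<dots> = ?\<mu> / ?q ^ m"
      using q by (simp add: card mult_2 power_add)
    finally show ?thesis .
  qed
  moreover have "(\<Union>f\<in>?P m. F f) \<in> sets M"
    using fin F by (intro sets.finite_UN) auto
  ultimately show ?thesis by blast
qed

text \<open>Intersecting the covers for all m leaves a Borel set of measure at most q^(-m) times the
  total mass for every m, hence 0 because q > 1.\<close>

lemma line_union_subset_null_set:
  fixes M :: "('a::{field, finite} fps ^ 'n) measure"
  assumes M: "haar_measure M" and "i \<noteq> j"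
    and c: "\<And>m (f :: nat \<Rightarrow> 'a). \<exists>N. \<forall>j<m. \<forall>l<m. c (N + j) l = f l"
  shows "\<exists>E \<in> null_sets M. line_union c i j \<subseteq> E"
proof -
  interpret finite_measure M using M by (simp add: haar_measure_def)
  let ?q = "real CARD('a)" and ?\<mu> = "measure M (space M)"
  obtain F where F: "\<And>m. F m \<in> sets M" "\<And>m. line_union c i j \<subseteq> F m"
      "\<And>m. measure M (F m) \<le> ?\<mu> / ?q ^ m"
    using line_union_cover[OF assms] by metis
  have E: "(\<Inter>m. F m) \<in> sets M" using F(1) by auto
  have "card {0, 1 :: 'a} \<le> CARD('a)" by (intro card_mono) auto
  then have "1 < ?q" by simp
  then have "(\<lambda>m. ?\<mu> / ?q ^ m) \<longlonglongrightarrow> 0" by (rule LIMSEQ_divide_realpow_zero)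
  moreover have "measure M (\<Inter>m. F m) \<le> ?\<mu> / ?q ^ m" for m
    by (rule order_trans[OF finite_measure_mono F(3)]) (use F(1) in auto)
  ultimately have "measure M (\<Inter>m. F m) \<le> 0"
    by (intro LIMSEQ_le_const) auto
  then have "measure M (\<Inter>m. F m) = 0"
    using measure_nonneg[of M "\<Inter>m. F m"] by (rule antisym)
  then have "(\<Inter>m. F m) \<in> null_sets M"
    using E by (auto simp: null_sets_def emeasure_eq_measure)
  then show ?thesis using F(2) by blast
qed

theorem theorem1p1:
  fixes M :: "('a::{field, finite} fps ^ 'n) measure"
  assumes "CARD('n) > 1"
    and "haar_measure M"
  shows "\<exists>E. E \<in> null_sets M \<and> (\<forall>v. \<exists>x. \<forall>s. x + s *s v \<in> E)"
proof -
  obtain i j :: 'n where ij: "i \<noteq> j"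
    using assms(1) by (metis One_nat_def UNIV_I card_le_Suc0_iff_eq finite leD)
  obtain c :: "nat \<Rightarrow> nat \<Rightarrow> 'a"
    where c: "\<And>m (f :: nat \<Rightarrow> 'a). \<exists>N. \<forall>j<m. \<forall>l<m. c (N + j) l = f l"
    by (rule block_sequence_exists) blast
  obtain E E' where E: "E \<in> null_sets M" "line_union c i j \<subseteq> E"
      "E' \<in> null_sets M" "line_union c j i \<subseteq> E'"
    using line_union_subset_null_set[OF assms(2) ij c]
      line_union_subset_null_set[OF assms(2) ij[symmetric] c] by blast
  have "\<exists>x. \<forall>s. x + s *s v \<in> E \<union> E'" for v
  proof -
    \<comment> \<open>Power series over a field form a valuation ring: of two nonzero series, the
      one of smaller subdegree divides the other. \<open>E\<close> and \<open>E'\<close> serve the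
      two cases.\<close>
    have "v $ i dvd v $ j \<or> v $ j dvd v $ i"
      by (cases "v $ i = 0 \<or> v $ j = 0") (auto simp: fps_dvd_iff)
    then show ?thesis
      using line_in_line_union[OF ij, of v c] line_in_line_union[OF ij[symmetric], of v c] E(2,4)
      by blast
  qed
  then show ?thesis using E(1,3) by (intro exI[of _ "E \<union> E'"]) auto
qed

end
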